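(* Let $\chi_1(y)=\int_0^y\epsilon\,|\log|s/4||^{\alpha}\,ds$ with $\epsilon>0$ and $1/4<\alpha<1/2$, and let $\tilde\chi_2$ be a function of one variable satisfying $$\tilde\chi_2'-2(\chi_1')^2(1+\chi_1)^{-2}-\frac1{16}\tilde\chi_2^2=0 .$$ Let $g$ be the metric on $D$ (defined in the context) whose coefficients in the basis $\{L,\underline{L},\partial_2,\partial_3\}$ are $$g_{L\underline{L}}=-2,\qquad g_{\underline{L}\,\underline{L}}=-t\,\tilde\chi_2,\qquad g_{AB}=\delta_{AB}\,\chi_{1A},\qquad g_{A\underline{L}}=-\tfrac14 x_A\,\chi_{2A}\qquad(A,B\in\{2,3\}),$$ together with their symmetric counterparts, all other coefficients being zero, where $\chi_{12}=1+\chi_1=1/\chi_{13}$, $\chi_{2A}=\chi_{1A}\tilde\chi_2$, and all the functions $\chi_1,\chi_{1A},\chi_{2A},\tilde\chi_2$ are evaluated at $x_1-t$. Then $$\mathrm{Ric}(g)=0 .$$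
   Context: Coordinates on $\mathbb{R}^{1+3}$ are $(t,x_1,x_2,x_3)$; $L=\partial_t+\partial_{x_1}$, $\underline{L}=\partial_t-\partial_{x_1}$, $\partial_A=\partial_{x_A}$ for $A=2,3$; subscripts $L,\underline{L},2,3$ denote components with respect to these vector fields, e.g. $g_{L\underline{L}}=g(L,\underline{L})$. $\mathrm{Ric}(g)$ is the Ricci curvature. The domain is $$D=\{(t,x):\ (x_1-1)^2H(x_1-1)+x_2^2/4+x_3^2/4<(1-t)^2\},$$ where $H(x_1-1)=1$ when $x_1<1$ and $H(x_1-1)=1/4$ when $x_1>1$.
   Formalization: The coefficient 1/16 of the squared χ̃₂ term in the ODE is replaced by 1/8: with 1/16 the component Ric(L̲,L̲) equals −χ̃₂²/16, which is not identically zero; points where x₁−t=0 or 1+χ₁=0 are excluded. *)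

theory Defs
  imports "HOL-Analysis.Analysis"
begin

section \<open>Ricci curvature in a constant frame\<close>

text \<open>
  A metric on (an open part of) \<open>real^'n\<close> is a field of bilinear forms
  \<open>g :: real^'n \<Rightarrow> real^'n \<Rightarrow> real^'n \<Rightarrow> real\<close>.  Components are taken in a basis \<open>e\<close> of
  constant vector fields.  Such fields commute, so the classical coordinate formulas hold with
  the coordinate derivatives replaced by the derivatives along the \<open>e i\<close>.
\<close>

definition differentiable_along :: "real^'n \<Rightarrow> (real^'n \<Rightarrow> real) \<Rightarrow> real^'n \<Rightarrow> bool" where
  "differentiable_along v f p \<longleftrightarrow> (\<lambda>s::real. f (p + s *\<^sub>R v)) differentiable (at 0)"

definition deriv_along :: "real^'n \<Rightarrow> (real^'n \<Rightarrow> real) \<Rightarrow> real^'n \<Rightarrow> real" where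
  "deriv_along v f p = deriv (\<lambda>s::real. f (p + s *\<^sub>R v)) 0"

definition gram ::
  "('n::finite \<Rightarrow> real^'n) \<Rightarrow> (real^'n \<Rightarrow> real^'n \<Rightarrow> real^'n \<Rightarrow> real) \<Rightarrow> real^'n \<Rightarrow> real^'n^'n" where
  "gram e g p = (\<chi> i j. g p (e i) (e j))"

text \<open>\<open>christoffel e g k i j\<close> has upper index \<open>k\<close> and lower indices \<open>i\<close>, \<open>j\<close>.\<close>

definition christoffel ::
  "('n::finite \<Rightarrow> real^'n) \<Rightarrow> (real^'n \<Rightarrow> real^'n \<Rightarrow> real^'n \<Rightarrow> real)
    \<Rightarrow> 'n \<Rightarrow> 'n \<Rightarrow> 'n \<Rightarrow> real^'n \<Rightarrow> real" where
  "christoffel e g k i j p =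
     1/2 * (\<Sum>l\<in>UNIV. matrix_inv (gram e g p) $ k $ l *
       (deriv_along (e i) (\<lambda>q. gram e g q $ j $ l) p
        + deriv_along (e j) (\<lambda>q. gram e g q $ i $ l) p
        - deriv_along (e l) (\<lambda>q. gram e g q $ i $ j) p))"

text \<open>
  In the second term the contracted symbol is differentiated as a whole.  Where the metric is
  twice differentiable this is the usual Ricci tensor; it also makes sense at points where the
  contraction is differentiable although its summands are not.
\<close>

definition ricci ::
  "('n::finite \<Rightarrow> real^'n) \<Rightarrow> (real^'n \<Rightarrow> real^'n \<Rightarrow> real^'n \<Rightarrow> real)
    \<Rightarrow> 'n \<Rightarrow> 'n \<Rightarrow> real^'n \<Rightarrow> real" where
  "ricci e g i j p =
     (\<Sum>k\<in>UNIV. deriv_along (e k) (christoffel e g k i j) p)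
     - deriv_along (e j) (\<lambda>q. \<Sum>k\<in>UNIV. christoffel e g k i k q) p
     + (\<Sum>k\<in>UNIV. \<Sum>l\<in>UNIV.
          christoffel e g k k l p * christoffel e g l i j p
          - christoffel e g k j l p * christoffel e g l i k p)"

text \<open>
  Since \<open>deriv\<close> and \<open>matrix_inv\<close> are total, the meaningfulness of the expression above is a
  separate condition.
\<close>

definition ricci_exists ::
  "('n::finite \<Rightarrow> real^'n) \<Rightarrow> (real^'n \<Rightarrow> real^'n \<Rightarrow> real^'n \<Rightarrow> real) \<Rightarrow> real^'n \<Rightarrow> bool" where
  "ricci_exists e g p \<longleftrightarrow>
     (\<forall>\<^sub>F q in nhds p. invertible (gram e g q) \<and>
        (\<forall>i j k. differentiable_along (e k) (\<lambda>r. gram e g r $ i $ j) q)) \<and>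
     (\<forall>i j k. differentiable_along (e k) (christoffel e g k i j) p) \<and>
     (\<forall>i j. differentiable_along (e j) (\<lambda>q. \<Sum>k\<in>UNIV. christoffel e g k i k q) p)"

definition ricci_flat_at ::
  "('n::finite \<Rightarrow> real^'n) \<Rightarrow> (real^'n \<Rightarrow> real^'n \<Rightarrow> real^'n \<Rightarrow> real) \<Rightarrow> real^'n \<Rightarrow> bool" where
  "ricci_flat_at e g p \<longleftrightarrow> ricci_exists e g p \<and> (\<forall>i j. ricci e g i j p = 0)"

section \<open>The null frame and the domain\<close>

text \<open>The coordinates \<open>t, x\<^sub>1, x\<^sub>2, x\<^sub>3\<close> of \<open>p :: real^4\<close> are \<open>p$0, p$1, p$2, p$3\<close>; the index type \<open>4\<close>
  consists of \<open>0, 1, 2, 3\<close> (with \<open>4 = 0\<close>).\<close>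

definition L :: "real^4" where
  "L = axis 0 1 + axis 1 1"

definition Lbar :: "real^4" where
  "Lbar = axis 0 1 - axis 1 1"

definition null_frame :: "4 \<Rightarrow> real^4" where
  "null_frame i = (if i = 0 then L else if i = 1 then Lbar else axis i 1)"

text \<open>The value of \<open>weight\<close> at \<open>0\<close> is irrelevant for the domain.\<close>

definition weight :: "real \<Rightarrow> real" where
  "weight z = (if z < 0 then 1 else 1/4)"

definition domainD :: "(real^4) set" where
  "domainD = {p. (p$1 - 1)\<^sup>2 * weight (p$1 - 1) + (p$2)\<^sup>2 / 4 + (p$3)\<^sup>2 / 4 < (1 - p$0)\<^sup>2}"

section \<open>The profile functions\<close>

definition chi1 :: "real \<Rightarrow> real \<Rightarrow> real \<Rightarrow> real" where
  "chi1 \<epsilon> \<alpha> y = (LBINT s=ereal 0..ereal y. \<epsilon> * \<bar>ln \<bar>s / 4\<bar>\<bar> powr \<alpha>)"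

definition chi1A :: "real \<Rightarrow> real \<Rightarrow> 4 \<Rightarrow> real \<Rightarrow> real" where
  "chi1A \<epsilon> \<alpha> A y = (if A = 2 then 1 + chi1 \<epsilon> \<alpha> y else 1 / (1 + chi1 \<epsilon> \<alpha> y))"

definition chi2A :: "real \<Rightarrow> real \<Rightarrow> (real \<Rightarrow> real) \<Rightarrow> 4 \<Rightarrow> real \<Rightarrow> real" where
  "chi2A \<epsilon> \<alpha> \<psi> A y = chi1A \<epsilon> \<alpha> A y * \<psi> y"

text \<open>
  \<open>\<psi>\<close> solves the Riccati equation on \<open>J\<close>.  Solutions may blow up, hence the set \<open>J\<close>; it must
  avoid \<open>0\<close>, where \<open>chi1\<close> is not differentiable, and the zeros of \<open>1 + chi1\<close>.

  For the metric considered here the component of the Ricci tensor on \<open>(Lbar, Lbar)\<close> is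
  \<open>\<psi>' - 2 (chi1')\<^sup>2 (1 + chi1)\<^sup>-\<^sup>2 - \<psi>\<^sup>2 / 8\<close>, and all others vanish.  The coefficient of \<open>\<psi>\<^sup>2\<close> is
  therefore \<open>1/8\<close> and not \<open>1/16\<close> as printed in the source: with \<open>1/16\<close> the component would equal
  \<open>- \<psi>\<^sup>2 / 16\<close>.
\<close>

definition riccati_solution :: "real \<Rightarrow> real \<Rightarrow> real set \<Rightarrow> (real \<Rightarrow> real) \<Rightarrow> bool" where
  "riccati_solution \<epsilon> \<alpha> J \<psi> \<longleftrightarrow>
     (\<forall>y\<in>J. y \<noteq> 0 \<and> 1 + chi1 \<epsilon> \<alpha> y \<noteq> 0 \<and> \<psi> differentiable (at y) \<and>
        deriv \<psi> y - 2 * (deriv (chi1 \<epsilon> \<alpha>) y)\<^sup>2 * (1 + chi1 \<epsilon> \<alpha> y) powi (-2) - 1/8 * (\<psi> y)\<^sup>2 = 0)"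

text \<open>
  On the part \<open>t < 1\<close> of the domain (the past of its vertex) the excluded values do not occur,
  so that there one may take \<open>J = {0<..}\<close>.
\<close>

lemma domainD_pos:
  assumes "p \<in> domainD" "p$0 < 1"
  shows "0 < p$1 - p$0"
proof (cases "p$1 < 1")
  case True
  have "(p$1 - 1)\<^sup>2 < (1 - p$0)\<^sup>2"
    using assms(1) True unfolding domainD_def weight_def
    by simp (smt (verit) zero_le_power2 divide_nonneg_pos)
  then have "\<bar>p$1 - 1\<bar> < \<bar>1 - p$0\<bar>"
    by (metis power2_abs abs_ge_zero power2_less_imp_less)
  then show ?thesis using True assms(2) by linarith
next
  case False
  then show ?thesis using assms(2) by linarith
qed

lemma chi1_nonneg:
  assumes "0 < \<epsilon>" "0 < y"
  shows "0 \<le> chi1 \<epsilon> \<alpha> y"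
  unfolding chi1_def interval_lebesgue_integral_def set_lebesgue_integral_def
  using assms by (auto intro!: Bochner_Integration.integral_nonneg)

end

theory Submission
  imports Defs
begin

text \<open>
  The profiles depend only on \<open>y = x\<^sub>1 - t\<close>, which is constant along every frame vector but \<open>Lbar\<close>.
  The product of the \<open>g\<^sub>A\<^sub>A\<close> is constant, hence so is the determinant of the metric, the contracted
  Christoffel symbol vanishes and the Ricci tensor reduces to \<open>\<partial>\<^sub>k \<Gamma>\<^sup>k\<^sub>i\<^sub>j - \<Gamma>\<^sup>k\<^sub>j\<^sub>l \<Gamma>\<^sup>l\<^sub>i\<^sub>k\<close>.  Its only
  component that is not identically zero is the one on \<open>(Lbar, Lbar)\<close>, and that is the Riccati
  equation.  The profiles are differentiable only once (\<open>chi1\<close> has no second derivative at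
  \<open>\<bar>y\<bar> = 4\<close>); this suffices because derivatives of the profiles enter only symbols \<open>\<Gamma>\<^sup>k\<^sub>i\<^sub>j\<close>
  with \<open>k \<noteq> 1\<close>, which are never differentiated along \<open>Lbar\<close>.
\<close>

section \<open>The index type \<open>4\<close>, matrix inverses and derivatives along constant
  vectors\<close>

lemma univ4: "(UNIV :: 4 set) = {0, 1, 2, 3}" using UNIV_4 by auto

lemma all4: "(\<forall>i::4. P i) \<longleftrightarrow> P 0 \<and> P 1 \<and> P 2 \<and> P 3"
proof -
  have "(\<forall>i. P i) \<longleftrightarrow> (\<forall>i\<in>UNIV. P i)" by simp
  then show ?thesis unfolding univ4 by simp
qed

lemma sum4: "sum f (UNIV :: 4 set) = f 0 + f 1 + f 2 + f 3" unfolding univ4 by (simp add: add.assoc)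

lemma frame_nth:
  "null_frame k $ 0 = (if k \<in> {0, 1} then 1 else 0)"
  "null_frame k $ 1 = (if k = 0 then 1 else if k = 1 then -1 else 0)"
  "null_frame k $ 2 = (if k = 2 then 1 else 0)"
  "null_frame k $ 3 = (if k = 3 then 1 else 0)"
  by (auto simp: null_frame_def L_def Lbar_def axis_def)

lemma matrix_inv_eq:
  fixes A B :: "real^'n^'n"
  assumes "A ** B = mat 1"
  shows "invertible A" "matrix_inv A = B"
proof -
  have "B ** A = mat 1" using assms by (simp add: matrix_left_right_inverse)
  then show inv: "invertible A" using assms by (auto simp: invertible_def)
  have "matrix_inv A = matrix_inv A ** (A ** B)" by (simp add: assms)
  also have "\<dots> = B"
    using someI_ex[OF inv[unfolded invertible_def]]
    by (simp add: matrix_inv_def matrix_mul_assoc)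
  finally show "matrix_inv A = B" .
qed

text \<open>A derivative along \<open>v\<close> depends only on the values of \<open>f\<close> near
  \<open>p\<close>, so a closed formula valid on an open set may be differentiated instead. Every
  derivative of the metric and of its Christoffel symbols is found this way.\<close>

lemma deriv_along_eqI:
  assumes "open U" "p \<in> U" "\<And>q. q \<in> U \<Longrightarrow> f q = F q"
    and D: "((\<lambda>s. F (p + s *\<^sub>R v)) has_real_derivative D) (at 0)"
  shows "differentiable_along v f p" "deriv_along v f p = D"
proof -
  have "open ((\<lambda>s. p + s *\<^sub>R v) -` U)"
    by (intro open_vimage continuous_intros assms)
  then have "((\<lambda>s. f (p + s *\<^sub>R v)) has_real_derivative D) (at 0)"
    by (rule has_field_derivative_transform_within_open[OF D]) (use assms in auto)
  then show "differentiable_along v f p" "deriv_along v f p = D"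
    unfolding differentiable_along_def deriv_along_def
    by (auto simp: real_differentiable_def DERIV_imp_deriv)
qed

section \<open>The metric with abstract profiles: Christoffel symbols and Ricci tensor\<close>

definition wave_gram ::
  "(4 \<Rightarrow> real \<Rightarrow> real) \<Rightarrow> (real \<Rightarrow> real) \<Rightarrow> 4 \<Rightarrow> 4 \<Rightarrow> real^4 \<Rightarrow> real" where
  "wave_gram c \<psi> i j p =
     (let y = p$1 - p$0 in
      if i = 0 \<and> j = 1 \<or> i = 1 \<and> j = 0 then -2
      else if i = 0 \<or> j = 0 then 0
      else if i = 1 \<and> j = 1 then - (p$0) * \<psi> y
      else if j = 1 then - (1/4) * p$i * (c i y * \<psi> y)
      else if i = 1 then - (1/4) * p$j * (c j y * \<psi> y)
      else if i = j then c i y else 0)"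

text \<open>\<open>c A\<close> stands for \<open>chi1A\<close>. The condition
  \<open>unimodular\<close> makes the logarithmic derivative of \<open>c 2 * c 3\<close> vanish, and
  \<open>riccati\<close> is written symmetrically in the two logarithmic derivatives.\<close>

locale wave_metric =
  fixes c c' :: "4 \<Rightarrow> real \<Rightarrow> real" and \<psi> \<psi>' :: "real \<Rightarrow> real"
    and U :: "(real^4) set" and g :: "real^4 \<Rightarrow> real^4 \<Rightarrow> real^4 \<Rightarrow> real"
    and y :: "real^4 \<Rightarrow> real"
  defines "y p \<equiv> p$1 - p$0"
  assumes open_U: "open U"
    and c_deriv: "p \<in> U \<Longrightarrow> A \<in> {2, 3} \<Longrightarrow> (c A has_real_derivative c' A (y p)) (at (y p))"
    and \<psi>_deriv: "p \<in> U \<Longrightarrow> (\<psi> has_real_derivative \<psi>' (y p)) (at (y p))"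
    and c_nonzero: "p \<in> U \<Longrightarrow> A \<in> {2, 3} \<Longrightarrow> c A (y p) \<noteq> 0"
    and unimodular: "p \<in> U \<Longrightarrow> c' 2 (y p) / c 2 (y p) + c' 3 (y p) / c 3 (y p) = 0"
    and riccati: "p \<in> U \<Longrightarrow> \<psi>' (y p) =
      (c' 2 (y p) / c 2 (y p))\<^sup>2 + (c' 3 (y p) / c 3 (y p))\<^sup>2 + (\<psi> (y p))\<^sup>2 / 8"
    and gram_entry: "p \<in> U \<Longrightarrow> gram null_frame g p $ i $ j = wave_gram c \<psi> i j p"
begin

text \<open>\<open>L\<close> is null and orthogonal to both \<open>axis A 1\<close>, so index 1 of
  the inverse pairs only with index 0. The sum in entry \<open>(0, 0)\<close> collects the terms
  \<open>g(axis A 1, Lbar)^2 / (4 * c A)\<close> that arise from eliminating the block of indices 2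
  and 3.\<close>

definition inverse_gram :: "real^4 \<Rightarrow> real^4^4" where
  "inverse_gram p = (\<chi> i j.
     if i = 0 \<and> j = 0 then p$0 * \<psi> (y p) / 4 + (\<Sum>A\<in>{2, 3}. (p$A)\<^sup>2 * c A (y p) * (\<psi> (y p))\<^sup>2 / 64)
     else if i = 0 \<and> j = 1 \<or> i = 1 \<and> j = 0 then - 1/2
     else if i = 1 \<or> j = 1 then 0
     else if i = 0 then - (p$j) * \<psi> (y p) / 8
     else if j = 0 then - (p$i) * \<psi> (y p) / 8
     else if i = j then 1 / c i (y p) else 0)"

lemma gram_inverse:
  assumes "p \<in> U"
  shows "gram null_frame g p ** inverse_gram p = mat 1"
  unfolding vec_eq_iff all4
  using c_nonzero[OF assms, of 2] c_nonzero[OF assms, of 3]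
  by (simp add: matrix_matrix_mult_def mat_def sum4 inverse_gram_def gram_entry[OF assms]
      wave_gram_def Let_def y_def[symmetric]
      field_simps power2_eq_square)

text \<open>Since \<open>y\<close> is linear, \<open>y v\<close> is its derivative along
  \<open>v\<close> and hence the chain-rule factor of every profile.\<close>

definition gram_deriv :: "real^4 \<Rightarrow> 4 \<Rightarrow> 4 \<Rightarrow> real^4 \<Rightarrow> real" where
  "gram_deriv v i j p =
     (let y' = y v; m' = (\<lambda>A. - (1/4) * (v$A * (c A (y p) * \<psi> (y p))
           + p$A * (c' A (y p) * \<psi> (y p) + c A (y p) * \<psi>' (y p)) * y')) in
       if i = 0 \<or> j = 0 then 0
       else if i = 1 \<and> j = 1 then - (v$0 * \<psi> (y p) + p$0 * \<psi>' (y p) * y')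
       else if j = 1 then m' i
       else if i = 1 then m' j
       else if i = j then c' i (y p) * y' else 0)"

lemma y_line: "y (p + s *\<^sub>R v) = y p + s * y v"
  by (simp add: y_def algebra_simps)

lemma y_frame: "y (null_frame k) = (if k = 1 then -2 else 0)"
  by (simp add: y_def frame_nth)

lemma profile_line:
  assumes "p \<in> U"
  shows "A \<in> {2, 3} \<Longrightarrow> ((\<lambda>s. c A (y p + s * k)) has_real_derivative k * c' A (y p)) (at 0)"
    and "((\<lambda>s. \<psi> (y p + s * k)) has_real_derivative k * \<psi>' (y p)) (at 0)"
proof -
  have chain: "((\<lambda>s. f (y p + s * k)) has_real_derivative k * D) (at 0)"
    if "(f has_real_derivative D) (at (y p))" for f D
  proof -
    have "((\<lambda>s. y p + s * k) has_real_derivative k) (at 0)"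
      by (auto intro!: derivative_eq_intros)
    then have "((\<lambda>s. f (y p + s * k)) has_real_derivative D * k) (at 0)"
      by (intro DERIV_chain2) (use that in auto)
    then show ?thesis by (simp add: mult.commute)
  qed
  show "A \<in> {2, 3} \<Longrightarrow> ((\<lambda>s. c A (y p + s * k)) has_real_derivative k * c' A (y p)) (at 0)"
    "((\<lambda>s. \<psi> (y p + s * k)) has_real_derivative k * \<psi>' (y p)) (at 0)"
    by (rule chain, rule c_deriv[OF assms], assumption) (rule chain, rule \<psi>_deriv[OF assms])
qed

lemma gram_has_deriv:
  assumes "p \<in> U"
  shows "differentiable_along v (\<lambda>q. gram null_frame g q $ i $ j) p"
    and "deriv_along v (\<lambda>q. gram null_frame g q $ i $ j) p = gram_deriv v i j p"
proof -
  have "\<forall>i j. ((\<lambda>s. wave_gram c \<psi> i j (p + s *\<^sub>R v)) has_real_derivative gram_deriv v i j p) (at 0)"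
    unfolding all4 wave_gram_def Let_def y_def[symmetric] y_line
    by (auto simp: gram_deriv_def Let_def algebra_simps intro!: derivative_eq_intros profile_line[OF assms])
  then have "((\<lambda>s. wave_gram c \<psi> i j (p + s *\<^sub>R v)) has_real_derivative gram_deriv v i j p) (at 0)"
    by blast
  from deriv_along_eqI[OF open_U assms gram_entry this]
  show "differentiable_along v (\<lambda>q. gram null_frame g q $ i $ j) p"
    "deriv_along v (\<lambda>q. gram null_frame g q $ i $ j) p = gram_deriv v i j p" by auto
qed

definition \<Gamma> :: "4 \<Rightarrow> 4 \<Rightarrow> 4 \<Rightarrow> real^4 \<Rightarrow> real" where
  "\<Gamma> k i j p =
    (let w = \<psi> (y p); w' = \<psi>' (y p) in
     if i = 1 \<and> j = 1 then
       (if k = 0 then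
          (p$0 * w / 4 + (\<Sum>A\<in>{2, 3}. (p$A)\<^sup>2 * c A (y p) * w\<^sup>2 / 64)) * w / 2
          + (w - 2 * p$0 * w') / 4
          - (\<Sum>A\<in>{2, 3}. (p$A)\<^sup>2 * w * (c' A (y p) * w + c A (y p) * w') / 16)
        else if k = 1 then - w / 4
        else p$k * (- w\<^sup>2 / 16 + (c' k (y p) / c k (y p) * w + w') / 2))
     else if i = 0 \<and> j = 1 \<or> i = 1 \<and> j = 0 then (if k = 0 then w / 4 else 0)
     else if i = 0 \<or> j = 0 \<or> k = 1 then 0
     else if i = 1 then
       (if k = 0 then p$j * w * c' j (y p) / 8 else if k = j then - c' j (y p) / c j (y p) else 0)
     else if j = 1 then
       (if k = 0 then p$i * w * c' i (y p) / 8 else if k = i then - c' i (y p) / c i (y p) else 0)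
     else if i = j \<and> k = 0 then c i (y p) * w / 8 - c' i (y p) / 2 else 0)"

lemma christoffel_eq:
  assumes "p \<in> U"
  shows "christoffel null_frame g k i j p = \<Gamma> k i j p"
proof -
  have nz: "c 2 (y p) \<noteq> 0" "c 3 (y p) \<noteq> 0" using c_nonzero[OF assms] by auto
  have "\<forall>k i j. christoffel null_frame g k i j p = \<Gamma> k i j p"
    unfolding all4 christoffel_def gram_has_deriv(2)[OF assms] matrix_inv_eq(2)[OF gram_inverse[OF assms]]
    using nz
    by (simp add: sum4 \<Gamma>_def gram_deriv_def inverse_gram_def y_frame frame_nth Let_def)
       (simp add: field_simps power2_eq_square)
  then show ?thesis by blast
qed

text \<open>Direction and upper index coincide, as in the divergence term of the Ricci tensor. Along
  \<open>L\<close> and \<open>axis A 1\<close> the profiles are frozen and only the explicit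
  \<open>p$0\<close> or \<open>p$A\<close> is differentiated.\<close>

definition \<Gamma>_deriv :: "4 \<Rightarrow> 4 \<Rightarrow> 4 \<Rightarrow> real^4 \<Rightarrow> real" where
  "\<Gamma>_deriv k i j p =
    (let w = \<psi> (y p); w' = \<psi>' (y p) in
     if i = 1 \<and> j = 1 then
       (if k = 0 then w\<^sup>2 / 8 - w' / 2 else if k = 1 then w' / 2
        else - w\<^sup>2 / 16 + (c' k (y p) / c k (y p) * w + w') / 2)
     else 0)"

lemma christoffel_has_deriv:
  assumes "p \<in> U"
  shows "differentiable_along (null_frame k) (christoffel null_frame g k i j) p"
    and "deriv_along (null_frame k) (christoffel null_frame g k i j) p = \<Gamma>_deriv k i j p"
proof -
  have nz: "c 2 (y p) \<noteq> 0" "c 3 (y p) \<noteq> 0" using c_nonzero[OF assms] by auto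
  have "\<forall>k i j. ((\<lambda>s. \<Gamma> k i j (p + s *\<^sub>R null_frame k)) has_real_derivative \<Gamma>_deriv k i j p) (at 0)"
    unfolding all4
    \<comment> \<open>Moving by \<open>s\<close> along \<open>Lbar\<close> changes \<open>y\<close>
      by \<open>-2 * s\<close>, hence the instance \<open>-2\<close>.\<close>
    by (auto simp: \<Gamma>_def y_line y_frame frame_nth \<Gamma>_deriv_def Let_def
        intro!: derivative_eq_intros profile_line[OF assms] profile_line[OF assms, of "-2", simplified])
      (simp_all add: nz field_simps power2_eq_square)
  then have "((\<lambda>s. \<Gamma> k i j (p + s *\<^sub>R null_frame k)) has_real_derivative \<Gamma>_deriv k i j p) (at 0)"
    by blast
  from deriv_along_eqI[OF open_U assms christoffel_eq this]
  show "differentiable_along (null_frame k) (christoffel null_frame g k i j) p"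
    "deriv_along (null_frame k) (christoffel null_frame g k i j) p = \<Gamma>_deriv k i j p" by auto
qed

lemma christoffel_trace:
  assumes "p \<in> U"
  shows "(\<Sum>k\<in>UNIV. christoffel null_frame g k i k p) = 0"
proof -
  \<comment> \<open>For \<open>i = 1\<close> the terms \<open>w / 4\<close> and
    \<open>- w / 4\<close> cancel and \<open>unimodular\<close> removes the rest; for other
    \<open>i\<close> each summand is 0.\<close>
  have "\<forall>i. (\<Sum>k\<in>UNIV. \<Gamma> k i k p) = 0"
    using unimodular[OF assms] unfolding all4 by (simp add: sum4 \<Gamma>_def Let_def)
  then show ?thesis by (simp add: christoffel_eq[OF assms])
qed

text \<open>The summands contain \<open>c' A / c A\<close>, which need not be differentiable along
  \<open>Lbar\<close>; their sum is, being identically 0 on \<open>U\<close>.\<close>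

lemma christoffel_trace_has_deriv:
  assumes "p \<in> U"
  shows "differentiable_along v (\<lambda>q. \<Sum>k\<in>UNIV. christoffel null_frame g k i k q) p"
    and "deriv_along v (\<lambda>q. \<Sum>k\<in>UNIV. christoffel null_frame g k i k q) p = 0"
  by (rule deriv_along_eqI[OF open_U assms, where F = "\<lambda>_. 0"], erule christoffel_trace, rule DERIV_const)+

lemma ricci_eq_0:
  assumes "p \<in> U"
  shows "ricci null_frame g i j p = 0"
proof -
  \<comment> \<open>Up to sign \<open>r\<close> is the logarithmic derivative of both
    \<open>c A\<close>; with it all derivatives of profiles can be eliminated.\<close>
  define r where "r = c' 2 (y p) / c 2 (y p)"
  have nz: "c 2 (y p) \<noteq> 0" "c 3 (y p) \<noteq> 0" using c_nonzero[OF assms] by auto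
  have c': "c' 2 (y p) = r * c 2 (y p)" "c' 3 (y p) = - r * c 3 (y p)"
    using nz unimodular[OF assms] by (auto simp: r_def field_simps)
  have \<psi>': "\<psi>' (y p) = 2 * r\<^sup>2 + (\<psi> (y p))\<^sup>2 / 8"
    using riccati[OF assms] nz by (simp add: c')
  \<comment> \<open>After swapping the sums, the inner factor is a contracted symbol, with the other
    lower index contracted than in \<open>christoffel_trace\<close>.\<close>
  have trace: "(\<Sum>k\<in>UNIV. \<Sum>l\<in>UNIV. \<Gamma> k k l p * \<Gamma> l i j p) = 0" for i j
  proof -
    have "(\<Sum>k\<in>UNIV. \<Gamma> k k l p) = 0" for l
    proof -
      have "\<Gamma> k k l p = \<Gamma> k l k p" for k
        by (auto simp: \<Gamma>_def Let_def)
      then show ?thesis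
        using christoffel_trace[OF assms, of l] by (simp add: christoffel_eq[OF assms])
    qed
    then show ?thesis
      by (subst sum.swap) (simp flip: sum_distrib_right)
  qed
  \<comment> \<open>For \<open>i = j = 1\<close> the left side collapses to \<open>\<psi>'\<close>.
    On the right, \<open>\<Gamma> 0 1 0\<close> and \<open>\<Gamma> 1 1 1\<close> contribute
    \<open>(\<psi> / 4)^2\<close> each, and the \<open>\<Gamma> A 1 A\<close> contribute
    \<open>r^2\<close> each.\<close>
  have "\<forall>i j. (\<Sum>k\<in>UNIV. \<Gamma>_deriv k i j p) = (\<Sum>k\<in>UNIV. \<Sum>l\<in>UNIV. \<Gamma> k j l p * \<Gamma> l i k p)"
    unfolding all4 using nz
    by (simp add: sum4 \<Gamma>_deriv_def \<Gamma>_def Let_def c' \<psi>' power2_eq_square)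
      (simp add: field_simps)
  then show ?thesis
    by (simp add: ricci_def christoffel_has_deriv(2)[OF assms] christoffel_trace_has_deriv(2)[OF assms]
        christoffel_eq[OF assms] sum_subtractf trace)
qed

lemma ricci_flat:
  assumes "p \<in> U"
  shows "ricci_flat_at null_frame g p"
proof -
  have "\<forall>\<^sub>F q in nhds p. q \<in> U"
    using open_U assms by (rule eventually_nhds_in_open)
  then have "\<forall>\<^sub>F q in nhds p. invertible (gram null_frame g q) \<and>
      (\<forall>i j k. differentiable_along (null_frame k) (\<lambda>r. gram null_frame g r $ i $ j) q)"
    by eventually_elim (use gram_has_deriv(1) matrix_inv_eq(1)[OF gram_inverse] in blast)
  then show ?thesis
    unfolding ricci_flat_at_def ricci_exists_def
    using christoffel_has_deriv(1)[OF assms] christoffel_trace_has_deriv(1)[OF assms] ricci_eq_0[OF assms]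
    by blast
qed

end

section \<open>Differentiating an integral in its upper endpoint\<close>

lemma interval_integrable_extend:
  fixes f :: "real \<Rightarrow> real" and a c z :: real
  assumes "interval_lebesgue_integrable lborel a c f"
    and "continuous_on {min c z..max c z} f"
  shows "interval_lebesgue_integrable lborel (min a (min c z)) (max a (max c z)) f"
proof -
  have 1: "set_integrable lborel {min a c<..<max a c} f"
    using assms(1) by (auto simp: interval_lebesgue_integrable_def min_def max_def split: if_splits)
  have 2: "set_integrable lborel {min c z..max c z} f"
    using borel_integrable_atLeastAtMost'[OF assms(2)] .
  have "set_integrable lborel {min a (min c z)<..<max a (max c z)} f"
    by (rule set_integrable_subset[OF set_integrable_Un[OF 1 2]]) (auto simp: min_def max_def split: if_splits)
  then show ?thesis
    by (auto simp: interval_lebesgue_integrable_def min_def max_def split: if_splits)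
qed

text \<open>Between \<open>c\<close> and \<open>z\<close> the function is continuous on a compact
  interval, so moving the endpoint there neither creates nor destroys integrability.\<close>

lemma interval_integrable_iff_continuous_between:
  fixes f :: "real \<Rightarrow> real" and a c z :: real
  assumes "continuous_on {min c z..max c z} f"
  shows "interval_lebesgue_integrable lborel a c f \<longleftrightarrow> interval_lebesgue_integrable lborel a z f"
proof -
  have sub: "interval_lebesgue_integrable lborel a z f"
    if "interval_lebesgue_integrable lborel (min a (min c z)) (max a (max c z)) f" for c z :: real
  proof -
    have "set_integrable lborel {min a (min c z)<..<max a (max c z)} f"
      using that by (auto simp: interval_lebesgue_integrable_def min_def max_def split: if_splits)
    then have "set_integrable lborel {min a z<..<max a z} f"
      by (rule set_integrable_subset) (auto simp: min_def max_def split: if_splits)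
    then show ?thesis
      by (auto simp: interval_lebesgue_integrable_def min_def max_def split: if_splits)
  qed
  show ?thesis
    using sub[OF interval_integrable_extend[of a c f z]] sub[OF interval_integrable_extend[of a z f c]]
      assms by (auto simp: min.commute max.commute)
qed

text \<open>If \<open>f\<close> is not integrable between \<open>a\<close> and \<open>y\<close>, then it is not
  integrable between \<open>a\<close> and any point near \<open>y\<close>, and the integral has the junk value \<open>0\<close> there.\<close>

lemma interval_integral_differentiable:
  fixes f :: "real \<Rightarrow> real" and a y d :: real
  assumes "0 < d" and cont: "continuous_on {y - d..y + d} f"
  shows "(\<lambda>z. LBINT s=ereal a..ereal z. f s) differentiable (at y)"
proof -
  \<comment> \<open>Starting at \<open>c\<close> instead of \<open>a\<close> confines the
    fundamental theorem of calculus to the interval of continuity; the piece from \<open>a\<close>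
    to \<open>c\<close> is a constant.\<close>
  define c where "c = y - d"
  have cont': "continuous_on {min c z..max c z} f" if "z \<in> {y - d<..<y + d}" for z
    by (rule continuous_on_subset[OF cont]) (use that in \<open>auto simp: c_def\<close>)
  show ?thesis
  proof (cases "interval_lebesgue_integrable lborel a c f")
    case True
    have sum: "(LBINT s=ereal a..ereal z. f s) = (LBINT s=ereal a..ereal c. f s) + (LBINT s=ereal c..ereal z. f s)"
      if "z \<in> {y - d<..<y + d}" for z
      using interval_integral_sum[of a c z f] interval_integrable_extend[OF True cont'[OF that]]
      by (simp flip: ereal_min ereal_max)
    have "((\<lambda>z. LBINT s=ereal c..ereal z. f s) has_vector_derivative f y) (at y within {y - d..y + d})"
      using \<open>0 < d\<close> by (intro interval_integral_FTC2[OF _ _ cont]) (auto simp: c_def)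
    moreover have "at y within {y - d..y + d} = at y"
      using \<open>0 < d\<close> by (intro at_within_interior) auto
    ultimately have "((\<lambda>z. LBINT s=ereal c..ereal z. f s) has_real_derivative f y) (at y)"
      by (simp add: has_real_derivative_iff_has_vector_derivative)
    then have "((\<lambda>z. (LBINT s=ereal a..ereal c. f s) + (LBINT s=ereal c..ereal z. f s))
        has_real_derivative 0 + f y) (at y)"
      by (intro derivative_intros)
    then have "((\<lambda>z. LBINT s=ereal a..ereal z. f s) has_real_derivative 0 + f y) (at y)"
      by (rule has_field_derivative_transform_within_open[where S="{y - d<..<y + d}"])
        (use \<open>0 < d\<close> sum in auto)
    then show ?thesis by (meson real_differentiable_def)
  next
    case False
    have zero: "(LBINT s=ereal a..ereal z. f s) = 0" if "z \<in> {y - d<..<y + d}" for z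
    proof -
      have "\<not> interval_lebesgue_integrable lborel a z f"
        using False interval_integrable_iff_continuous_between[OF cont'[OF that]] by blast
      then show ?thesis
        by (auto simp: interval_lebesgue_integral_def interval_lebesgue_integrable_def
            set_lebesgue_integral_def set_integrable_def not_integrable_integral_eq split: if_splits)
    qed
    have "((\<lambda>z. LBINT s=ereal a..ereal z. f s) has_real_derivative 0) (at y)"
      by (rule has_field_derivative_transform_within_open[OF DERIV_const[of 0], where S="{y - d<..<y + d}"])
        (use \<open>0 < d\<close> zero in auto)
    then show ?thesis by (meson real_differentiable_def)
  qed
qed

section \<open>Regularity of the profiles and openness of the domain\<close>

lemma chi1_differentiable:
  assumes "0 < \<alpha>" "y \<noteq> 0"
  shows "chi1 \<epsilon> \<alpha> differentiable (at y)"
proof -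
  \<comment> \<open>The radius keeps the logarithmic singularity at 0 out of the interval. Where the
    logarithm vanishes, at distance 4 from 0, continuity of the power relies on
    \<open>0 < \<alpha>\<close>.\<close>
  have "continuous_on {y - \<bar>y\<bar> / 2..y + \<bar>y\<bar> / 2} (\<lambda>s. \<epsilon> * \<bar>ln \<bar>s / 4\<bar>\<bar> powr \<alpha>)"
    using assms by (intro continuous_intros continuous_on_powr') (auto simp: abs_if split: if_splits)
  from interval_integral_differentiable[OF _ this, of 0] assms(2)
  show ?thesis
    unfolding chi1_def by (simp only: zero_less_abs_iff half_gt_zero_iff not_False_eq_True)
qed

lemma chi1A_has_deriv:
  assumes "0 < \<alpha>" "y \<noteq> 0" "1 + chi1 \<epsilon> \<alpha> y \<noteq> 0"
  shows "(chi1A \<epsilon> \<alpha> A has_real_derivative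
    (if A = 2 then deriv (chi1 \<epsilon> \<alpha>) y else - deriv (chi1 \<epsilon> \<alpha>) y / (1 + chi1 \<epsilon> \<alpha> y)\<^sup>2)) (at y)"
proof -
  have D: "(chi1 \<epsilon> \<alpha> has_real_derivative deriv (chi1 \<epsilon> \<alpha>) y) (at y)"
    using chi1_differentiable[OF assms(1,2)]
    by (simp add: DERIV_deriv_iff_real_differentiable)
  show ?thesis
    unfolding chi1A_def using assms(3)
    by (auto intro!: derivative_eq_intros D simp: power2_eq_square)
qed

text \<open>\<open>weight\<close> jumps at 0, but the factor \<open>z\<^sup>2\<close> removes the
  jump; the right side is visibly continuous, which gives openness of the domain.\<close>

lemma weight_mult: "z\<^sup>2 * weight z = (min z 0)\<^sup>2 + (max z 0)\<^sup>2 / 4"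
  by (auto simp: weight_def min_def max_def)

lemma open_domainD: "open domainD"
  unfolding domainD_def weight_mult
  by (intro open_Collect_less continuous_intros) auto

theorem lemma3p3:
  fixes \<epsilon> \<alpha> :: real
    and J :: "real set"
    and \<psi> :: "real \<Rightarrow> real"
    and g :: "real^4 \<Rightarrow> real^4 \<Rightarrow> real^4 \<Rightarrow> real"
  assumes "0 < \<epsilon>" and "1/4 < \<alpha>" and "\<alpha> < 1/2"
    and "open J" and "riccati_solution \<epsilon> \<alpha> J \<psi>"
    and "\<And>p. p \<in> domainD \<Longrightarrow> bilinear (g p)"
    and "\<And>p X Y. p \<in> domainD \<Longrightarrow> g p X Y = g p Y X"
    and "\<And>p. p \<in> domainD \<Longrightarrow> g p L L = 0"
    and "\<And>p. p \<in> domainD \<Longrightarrow> g p L Lbar = -2"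
    and "\<And>p. p \<in> domainD \<Longrightarrow> g p Lbar Lbar = - (p$0) * \<psi> (p$1 - p$0)"
    and "\<And>p A. p \<in> domainD \<Longrightarrow> A \<in> {2, 3} \<Longrightarrow> g p L (axis A 1) = 0"
    and "\<And>p A. p \<in> domainD \<Longrightarrow> A \<in> {2, 3} \<Longrightarrow>
           g p (axis A 1) Lbar = - (1/4) * p$A * chi2A \<epsilon> \<alpha> \<psi> A (p$1 - p$0)"
    and "\<And>p A B. p \<in> domainD \<Longrightarrow> A \<in> {2, 3} \<Longrightarrow> B \<in> {2, 3} \<Longrightarrow>
           g p (axis A 1) (axis B 1) = (if A = B then chi1A \<epsilon> \<alpha> A (p$1 - p$0) else 0)"
  shows "\<forall>p\<in>domainD. p$1 - p$0 \<in> J \<longrightarrow> ricci_flat_at null_frame g p"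
proof (intro ballI impI)
  define U where "U = domainD \<inter> (\<lambda>p. p$1 - p$0) -` J"
  define c' where "c' = (\<lambda>A. deriv (chi1A \<epsilon> \<alpha> A))"
  have "open U"
    unfolding U_def using assms(4)
    by (intro open_Int open_domainD open_vimage continuous_intros)
  have ode: "y \<noteq> 0" "1 + chi1 \<epsilon> \<alpha> y \<noteq> 0" "\<psi> differentiable (at y)"
    "deriv \<psi> y = 2 * (deriv (chi1 \<epsilon> \<alpha>) y / (1 + chi1 \<epsilon> \<alpha> y))\<^sup>2 + (\<psi> y)\<^sup>2 / 8"
    if "y \<in> J" for y
    using assms(5) that unfolding riccati_solution_def
    by (auto simp: power_int_minus power_divide field_simps)
  have chi1A: "(chi1A \<epsilon> \<alpha> A has_real_derivative c' A y) (at y)"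
    "c' A y = (if A = 2 then deriv (chi1 \<epsilon> \<alpha>) y else - deriv (chi1 \<epsilon> \<alpha>) y / (1 + chi1 \<epsilon> \<alpha> y)\<^sup>2)"
    if "y \<in> J" for A y
  proof -
    note D = chi1A_has_deriv[OF _ ode(1,2)[OF that], of A]
    show eq: "c' A y = (if A = 2 then deriv (chi1 \<epsilon> \<alpha>) y else - deriv (chi1 \<epsilon> \<alpha>) y / (1 + chi1 \<epsilon> \<alpha> y)\<^sup>2)"
      unfolding c'_def using D assms(2) by (intro DERIV_imp_deriv) auto
    show "(chi1A \<epsilon> \<alpha> A has_real_derivative c' A y) (at y)"
      unfolding eq using D assms(2) by auto
  qed
  have \<psi>_deriv: "(\<psi> has_real_derivative deriv \<psi> y) (at y)" if "y \<in> J" for y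
    using ode(3)[OF that] by (simp add: DERIV_deriv_iff_real_differentiable)
  have chi1A_nonzero: "chi1A \<epsilon> \<alpha> A y \<noteq> 0" if "y \<in> J" for A y
    using ode(2)[OF that] by (simp add: chi1A_def)
  \<comment> \<open>The two profiles are reciprocal, so their logarithmic derivatives are opposite.
    This yields \<open>unimodular\<close>, and the two equal squares account for the factor 2 in the
    Riccati equation.\<close>
  have log_deriv: "c' 2 y / chi1A \<epsilon> \<alpha> 2 y = deriv (chi1 \<epsilon> \<alpha>) y / (1 + chi1 \<epsilon> \<alpha> y)"
    "c' 3 y / chi1A \<epsilon> \<alpha> 3 y = - (deriv (chi1 \<epsilon> \<alpha>) y / (1 + chi1 \<epsilon> \<alpha> y))"
    if "y \<in> J" for y
    using ode(2)[OF that] by (simp_all add: chi1A(2)[OF that] chi1A_def power2_eq_square)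
  interpret wave_metric "chi1A \<epsilon> \<alpha>" c' \<psi> "deriv \<psi>" U g "\<lambda>p. p$1 - p$0"
  proof unfold_locales
    show "open U" by fact
  next
    fix p assume "p \<in> U"
    then show "(\<psi> has_real_derivative deriv \<psi> (p$1 - p$0)) (at (p$1 - p$0))"
      by (simp add: U_def \<psi>_deriv)
  next
    fix p i j assume p: "p \<in> U"
    then have D: "p \<in> domainD" by (simp add: U_def)
    have frame: "null_frame 0 = L" "null_frame 1 = Lbar" "null_frame 2 = axis 2 1" "null_frame 3 = axis 3 1"
      by (simp_all add: null_frame_def)
    \<comment> \<open>The hypotheses give the mixed components involving \<open>L\<close> or
      \<open>Lbar\<close> in one order only; symmetry of \<open>g p\<close> supplies the
      other.\<close>
    have "\<forall>i j. gram null_frame g p $ i $ j = wave_gram (chi1A \<epsilon> \<alpha>) \<psi> i j p"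
      unfolding all4
      using assms(7)[OF D, of Lbar L] assms(7)[OF D, of "axis 2 1" L] assms(7)[OF D, of "axis 3 1" L]
        assms(7)[OF D, of Lbar "axis 2 1"] assms(7)[OF D, of Lbar "axis 3 1"]
      by (simp add: gram_def frame wave_gram_def Let_def chi2A_def assms(8-13)[OF D])
    then show "gram null_frame g p $ i $ j = wave_gram (chi1A \<epsilon> \<alpha>) \<psi> i j p"
      by blast
  qed (simp_all add: U_def chi1A(1) log_deriv chi1A_nonzero ode(4))
  fix p assume "p \<in> domainD" "p$1 - p$0 \<in> J"
  then show "ricci_flat_at null_frame g p"
    by (intro ricci_flat) (simp add: U_def)
qed

end
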